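(* Let $A\in\mathbb{R}^{n\times n}$, with $n\geq2$, and write $$S=\frac{A+A^T}{2},\qquad K=\frac{A-A^T}{2}.$$ Suppose that $S$ has distinct eigenvalues $\lambda_1(S),\dots,\lambda_n(S)$, and define its eigenvalue gap $$\delta:=\min_{i\neq j}|\lambda_i(S)-\lambda_j(S)|.$$ If $\|K\|_F\leq \frac{\delta}{\sqrt{2}}$, then $S$ is a nearest normal matrix to $A$ over $\mathbb{C}^{n\times n}$, i.e. $\|A-S\|_F\le\|A-N\|_F$ for every normal $N\in\mathbb{C}^{n\times n}$. If the inequality $\|K\|_F\leq \frac{\delta}{\sqrt{2}}$ is strict, then $S$ is the unique minimizer of $\|A-N\|_F$ over all normal $N\in\mathbb{C}^{n\times n}$.
   Context: A matrix $N\in\mathbb{C}^{n\times n}$ is normal if $NN^*=N^*N$. $\|\cdot\|_F$ is the Frobenius norm. *)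

theory Defs
  imports
    "Jordan_Normal_Form.Schur_Decomposition"
    "Jordan_Normal_Form.Spectral_Radius"
begin

definition frobenius_norm :: "'a :: real_normed_vector mat \<Rightarrow> real" where
  "frobenius_norm A = sqrt (\<Sum>i<dim_row A. \<Sum>j<dim_col A. (norm (A $$ (i, j)))\<^sup>2)"

definition normal_mats :: "nat \<Rightarrow> complex mat set" where
  "normal_mats n = {N \<in> carrier_mat n n. N * mat_adjoint N = mat_adjoint N * N}"

definition nearest_normal :: "nat \<Rightarrow> complex mat \<Rightarrow> complex mat \<Rightarrow> bool" where
  "nearest_normal n A X \<longleftrightarrow>
     X \<in> normal_mats n \<and> (\<forall>N \<in> normal_mats n. frobenius_norm (A - X) \<le> frobenius_norm (A - N))"

end

theory Submission
  imports Defs "HOL-Analysis.L2_Norm"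
begin

text \<open>A normal matrix is \<open>N = W diag(d) W\<^sup>*\<close> with \<open>W\<close> unitary, so the squared distance from \<open>A\<close> to \<open>N\<close>
  is at least the squared norm of \<open>A\<close> minus the sum of \<open>|w\<^sup>* A w|\<^sup>2\<close> over the columns \<open>w\<close> of \<open>W\<close>.
  In a real orthonormal eigenbasis of \<open>S\<close> the matrix \<open>K\<close> keeps a zero diagonal. With \<open>p k = |w k|\<^sup>2\<close>
  and \<open>m\<close> the sum of \<open>p k * p l\<close> over \<open>k \<noteq> l\<close>, Cauchy-Schwarz gives that \<open>|w\<^sup>* K w|\<^sup>2\<close> is at most
  \<open>m\<close> times the squared norm of \<open>K\<close>, whereas the variance of the eigenvalues of \<open>S\<close> under the weights
  \<open>p\<close> is at least \<open>m \<delta>\<^sup>2 / 2\<close>. As \<open>w\<^sup>* S w\<close> is real and \<open>w\<^sup>* K w\<close> imaginary, this yields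
  \<open>|w\<^sup>* A w|\<^sup>2 \<le> |S w|\<^sup>2\<close>, and summing over the columns finishes the proof. In the strict case equality
  forces \<open>m = 0\<close> for every column, i.e. every column of \<open>W\<close> is an eigenvector of \<open>S\<close>.\<close>

section \<open>Entries of adjoints and of products\<close>

lemma mat_adjoint_dim [simp]:
  "dim_row (mat_adjoint A) = dim_col A" "dim_col (mat_adjoint A) = dim_row A"
  by (auto simp: mat_adjoint_def)

lemma mat_adjoint_carrier [simp]: "A \<in> carrier_mat m n \<Longrightarrow> mat_adjoint A \<in> carrier_mat n m"
  by (rule carrier_matI) simp_all

lemma mat_adjoint_index [simp]:
  "i < dim_col A \<Longrightarrow> j < dim_row A \<Longrightarrow> mat_adjoint A $$ (i, j) = conjugate (A $$ (j, i))"
  by (auto simp: mat_adjoint_def mat_of_rows_index)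

lemma mat_adjoint_adjoint [simp]: "mat_adjoint (mat_adjoint A) = A"
  by (rule eq_matI) auto

lemma mat_mult_index:
  assumes "A \<in> carrier_mat m n" "B \<in> carrier_mat n k" "i < m" "j < k"
  shows "(A * B) $$ (i, j) = (\<Sum>l<n. A $$ (i, l) * B $$ (l, j))"
  using assms by (auto simp: scalar_prod_def atLeast0LessThan)

lemma mat_adjoint_mult:
  fixes A B :: "complex mat"
  assumes "A \<in> carrier_mat m n" "B \<in> carrier_mat n k"
  shows "mat_adjoint (A * B) = mat_adjoint B * mat_adjoint A"
proof (rule eq_matI)
  fix i j assume "i < dim_row (mat_adjoint B * mat_adjoint A)" "j < dim_col (mat_adjoint B * mat_adjoint A)"
  then have ij: "i < k" "j < m" using assms by auto
  have "mat_adjoint (A * B) $$ (i, j) = conjugate ((A * B) $$ (j, i))"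
    using ij assms by simp
  also have "\<dots> = (\<Sum>l<n. mat_adjoint B $$ (i, l) * mat_adjoint A $$ (l, j))"
    unfolding mat_mult_index[OF assms ij(2,1)] using ij assms
    by (auto simp: mult.commute simp del: index_mult_mat intro!: sum.cong)
  also have "\<dots> = (mat_adjoint B * mat_adjoint A) $$ (i, j)"
    using assms ij by (subst mat_mult_index[of _ k n _ m]) auto
  finally show "mat_adjoint (A * B) $$ (i, j) = (mat_adjoint B * mat_adjoint A) $$ (i, j)" .
qed (use assms in auto)

lemma mat_adjoint_one [simp]: "mat_adjoint (1\<^sub>m n :: complex mat) = 1\<^sub>m n"
  by (rule eq_matI) auto

lemma mult_cnj_eq_cmod:
  "z * cnj z = complex_of_real ((cmod z)\<^sup>2)" "cnj z * z = complex_of_real ((cmod z)\<^sup>2)"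
  by (metis complex_norm_square mult.commute)+

section \<open>The squared Frobenius norm\<close>

definition frobenius_sq :: "complex mat \<Rightarrow> real" where
  "frobenius_sq A = (\<Sum>i<dim_row A. \<Sum>j<dim_col A. (cmod (A $$ (i, j)))\<^sup>2)"

lemma frobenius_norm_complex: "frobenius_norm A = sqrt (frobenius_sq A)"
  by (simp add: frobenius_norm_def frobenius_sq_def)

lemma frobenius_sq_nonneg [simp]: "frobenius_sq A \<ge> 0"
  by (simp add: frobenius_sq_def sum_nonneg)

lemma frobenius_sq_adjoint [simp]: "frobenius_sq (mat_adjoint A) = frobenius_sq A"
  unfolding frobenius_sq_def by (subst sum.swap) simp

text \<open>The norm depends on \<open>A\<close> only through its Gram matrix, which a unitary left
  factor leaves fixed; this is the route to unitary invariance.\<close>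

lemma frobenius_sq_gram:
  "complex_of_real (frobenius_sq A) = (\<Sum>j<dim_col A. (mat_adjoint A * A) $$ (j, j))"
proof -
  have "(mat_adjoint A * A) $$ (j, j) = (\<Sum>i<dim_row A. complex_of_real ((cmod (A $$ (i, j)))\<^sup>2))"
    if "j < dim_col A" for j
    using that by (subst mat_mult_index[of _ "dim_col A" "dim_row A" _ "dim_col A"])
      (auto simp: mult_cnj_eq_cmod)
  then show ?thesis
    unfolding frobenius_sq_def by (subst sum.swap) simp
qed

section \<open>Unitary matrices and unitary conjugation\<close>

definition is_unitary :: "nat \<Rightarrow> complex mat \<Rightarrow> bool" where
  "is_unitary n U \<longleftrightarrow> U \<in> carrier_mat n n \<and> mat_adjoint U * U = 1\<^sub>m n"

lemma is_unitaryD: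
  assumes "is_unitary n U"
  shows "U \<in> carrier_mat n n" "mat_adjoint U * U = 1\<^sub>m n" "U * mat_adjoint U = 1\<^sub>m n"
  using assms mat_mult_left_right_inverse[of "mat_adjoint U" n U] by (auto simp: is_unitary_def)

lemma is_unitary_adjoint: "is_unitary n U \<Longrightarrow> is_unitary n (mat_adjoint U)"
  unfolding is_unitary_def[of n "mat_adjoint U"]
  by (simp add: is_unitaryD mat_adjoint_carrier[of U n n])

lemma unitary_cancel:
  assumes "is_unitary n U" "M \<in> carrier_mat n m"
  shows "mat_adjoint U * (U * M) = M" "U * (mat_adjoint U * M) = M"
proof -
  note u = is_unitaryD[OF assms(1)]
  have "mat_adjoint U * (U * M) = (mat_adjoint U * U) * M" "U * (mat_adjoint U * M) = (U * mat_adjoint U) * M"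
    using u(1) assms(2) by (subst assoc_mult_mat[of _ n n _ n _ m]; simp)+
  then show "mat_adjoint U * (U * M) = M" "U * (mat_adjoint U * M) = M"
    using u assms(2) by simp_all
qed

lemma is_unitary_mult:
  assumes U: "is_unitary n U" and V: "is_unitary n V"
  shows "is_unitary n (U * V)"
proof -
  note u = is_unitaryD[OF U] and v = is_unitaryD[OF V]
  have "mat_adjoint (U * V) * (U * V) = mat_adjoint V * (mat_adjoint U * (U * V))"
    using u v by (simp add: mat_adjoint_mult[of _ n n _ n] assoc_mult_mat[of _ n n _ n _ n])
  also have "\<dots> = 1\<^sub>m n" using unitary_cancel[OF U v(1)] v by simp
  finally show ?thesis using u v by (simp add: is_unitary_def)
qed

lemma frobenius_sq_unitary_left:
  assumes U: "is_unitary n U" and M: "M \<in> carrier_mat n m"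
  shows "frobenius_sq (U * M) = frobenius_sq M"
proof -
  note u = is_unitaryD[OF U]
  have "mat_adjoint (U * M) * (U * M) = mat_adjoint M * (mat_adjoint U * (U * M))"
    using u M by (simp add: mat_adjoint_mult[of _ n n _ m] assoc_mult_mat[of _ m n _ n _ m])
  then have "mat_adjoint (U * M) * (U * M) = mat_adjoint M * M"
    using unitary_cancel[OF U M] by simp
  then have "complex_of_real (frobenius_sq (U * M)) = complex_of_real (frobenius_sq M)"
    unfolding frobenius_sq_gram using M u by simp
  then show ?thesis by simp
qed

text \<open>Entry (i, j) is the sesquilinear form of \<open>M\<close> at columns i and j of
  \<open>U\<close>; for unitary \<open>U\<close> this is \<open>M\<close> in the orthonormal basis
  of those columns.\<close>

definition conj_by :: "complex mat \<Rightarrow> complex mat \<Rightarrow> complex mat" where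
  "conj_by U M = mat_adjoint U * M * U"

lemma conj_by_carrier [simp]:
  "U \<in> carrier_mat n n \<Longrightarrow> M \<in> carrier_mat n n \<Longrightarrow> conj_by U M \<in> carrier_mat n n"
  by (auto simp: conj_by_def)

text \<open>The left factor drops by \<open>frobenius_sq_unitary_left\<close>; the right one becomes
  a left factor after passing to adjoints, which keeps the norm.\<close>

lemma frobenius_sq_conj_by:
  assumes U: "is_unitary n U" and M: "M \<in> carrier_mat n n"
  shows "frobenius_sq (conj_by U M) = frobenius_sq M"
proof -
  note u = is_unitaryD[OF U] and ua = is_unitary_adjoint[OF U]
  have "frobenius_sq (conj_by U M) = frobenius_sq (M * U)"
    using frobenius_sq_unitary_left[OF ua, of "M * U" n] u M
    by (simp add: conj_by_def assoc_mult_mat[of _ n n _ n _ n])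
  also have "\<dots> = frobenius_sq (mat_adjoint U * mat_adjoint M)"
    using u M by (simp flip: mat_adjoint_mult)
  also have "\<dots> = frobenius_sq M"
    using frobenius_sq_unitary_left[OF ua, of "mat_adjoint M" n] M by simp
  finally show ?thesis .
qed

lemma conj_by_add:
  assumes "U \<in> carrier_mat n n" "M \<in> carrier_mat n n" "N \<in> carrier_mat n n"
  shows "conj_by U (M + N) = conj_by U M + conj_by U N"
  using assms by (simp add: conj_by_def mult_add_distrib_mat[of _ n n _ n]
      add_mult_distrib_mat[where nr = n and n = n and nc = n]
      mult_carrier_mat[of _ n n _ n])

lemma conj_by_minus:
  assumes "U \<in> carrier_mat n n" "M \<in> carrier_mat n n" "N \<in> carrier_mat n n"
  shows "conj_by U (M - N) = conj_by U M - conj_by U N"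
  using assms by (simp add: conj_by_def mult_minus_distrib_mat[of _ n n _ n]
      minus_mult_distrib_mat[where nr = n and n = n and nc = n]
      mult_carrier_mat[of _ n n _ n])

lemma conj_by_adjoint:
  assumes "U \<in> carrier_mat n n" "M \<in> carrier_mat n n"
  shows "mat_adjoint (conj_by U M) = conj_by U (mat_adjoint M)"
  using assms by (simp add: conj_by_def mat_adjoint_mult[of _ n n _ n] assoc_mult_mat[of _ n n _ n _ n]
      mult_carrier_mat[of _ n n _ n])

lemma conj_by_conj_by:
  assumes "U \<in> carrier_mat n n" "V \<in> carrier_mat n n" "M \<in> carrier_mat n n"
  shows "conj_by V (conj_by U M) = conj_by (U * V) M"
  using assms by (simp add: conj_by_def mat_adjoint_mult[of _ n n _ n] assoc_mult_mat[of _ n n _ n _ n]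
      mult_carrier_mat[of _ n n _ n])

lemma conj_by_cancel:
  assumes U: "is_unitary n U" and "M \<in> carrier_mat n n"
  shows "conj_by (mat_adjoint U) (conj_by U M) = M"
  using is_unitaryD[OF U] assms(2)
  by (simp_all add: conj_by_conj_by[of _ n], simp_all add: conj_by_def mult_carrier_mat[of _ n n _ n])

lemma conj_by_mult:
  assumes U: "is_unitary n U" and M: "M \<in> carrier_mat n n" and N: "N \<in> carrier_mat n n"
  shows "conj_by U M * conj_by U N = conj_by U (M * N)"
  using is_unitaryD[OF U] M N unitary_cancel(2)[OF U, of "N * U" n]
  by (simp add: conj_by_def assoc_mult_mat[of _ n n _ n _ n]
      mult_carrier_mat[of _ n n _ n])

lemma conj_by_normal:
  assumes U: "is_unitary n U" and N: "N \<in> normal_mats n"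
  shows "conj_by U N \<in> normal_mats n"
  using N is_unitaryD[OF U]
  by (auto simp: normal_mats_def conj_by_adjoint[of _ n] conj_by_mult[OF U])

section \<open>Unitary triangularization and the spectral theorem for normal matrices\<close>

text \<open>Complete \<open>v\<close> to a basis and orthogonalize by Gram-Schmidt, which keeps the
  first vector; scaling the columns to length one accounts for the factor \<open>c\<close>.\<close>

lemma unitary_first_column:
  fixes v :: "complex vec"
  assumes v: "v \<in> carrier_vec n" and v0: "v \<noteq> 0\<^sub>v n"
  shows "\<exists>W c. is_unitary n W \<and> c \<noteq> 0 \<and> col W 0 = c \<cdot>\<^sub>v v"
proof -
  define b where "b = basis_completion v"
  define ws where "ws = gram_schmidt n b"
  interpret cof_vec_space n "TYPE(complex)" .
  have n: "n > 0" using v v0 by (cases n) auto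
  from basis_completion[OF v v0, folded b_def]
  have "distinct b" "\<not> lin_dep (set b)" "set b \<subseteq> carrier_vec n" and hdb: "hd b = v"
    and len_b: "length b = n" by auto
  from gram_schmidt_result[OF this(3,1,2) refl, folded ws_def]
  have ws: "set ws \<subseteq> carrier_vec n" "corthogonal ws" "length ws = n"
    by (auto simp: len_b)
  from hdb len_b n obtain vs where bv: "b = v # vs" by (cases b) auto
  from gram_schmidt_hd[OF v, of vs, folded bv] have "hd ws = v" unfolding ws_def .
  with ws n have ws0: "ws ! 0 = v" by (metis hd_conv_nth length_greater_0_conv)
  have wsc: "ws ! i \<in> carrier_vec n" if "i < n" for i using ws that by auto
  have [simp]: "dim_vec (ws ! i) = n" if "i < n" for i using wsc[OF that] by auto
  \<comment> \<open>The inverse length of the i-th vector; the self-product under the root is real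
    by \<open>sq\<close> below, so \<open>Re\<close> loses nothing.\<close>
  define c where "c i = complex_of_real (1 / sqrt (Re (ws ! i \<bullet>c ws ! i)))" for i
  have sq: "ws ! i \<bullet>c ws ! i = complex_of_real (\<Sum>k<n. (cmod (ws ! i $ k))\<^sup>2)" if "i < n" for i
    using wsc[OF that] by (auto simp: scalar_prod_def mult_cnj_eq_cmod atLeast0LessThan)
  have pos: "Re (ws ! i \<bullet>c ws ! i) > 0" if "i < n" for i
  proof -
    \<comment> \<open>\<open>corthogonal\<close> also asserts that self-products are
      nonzero.\<close>
    have "ws ! i \<bullet>c ws ! i \<noteq> 0" using corthogonalD[OF ws(2), of i i] ws that by auto
    then show ?thesis unfolding sq[OF that]
      by (metis Re_complex_of_real less_eq_real_def of_real_0 sum_nonneg zero_le_power2)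
  qed
  define W where "W = mat n n (\<lambda>(k, i). c i * ws ! i $ k)"
  have "mat_adjoint W * W = 1\<^sub>m n"
  proof (rule eq_matI)
    fix i j assume "i < dim_row (1\<^sub>m n :: complex mat)" "j < dim_col (1\<^sub>m n :: complex mat)"
    then have ij: "i < n" "j < n" by auto
    have "(mat_adjoint W * W) $$ (i, j) = (\<Sum>k<n. cnj (c i) * c j * (ws ! j $ k * cnj (ws ! i $ k)))"
      using ij by (subst mat_mult_index[of _ n n _ n]) (auto simp: W_def intro!: sum.cong)
    also have "\<dots> = cnj (c i) * c j * (ws ! j \<bullet>c ws ! i)"
      using wsc ij by (auto simp: scalar_prod_def sum_distrib_left atLeast0LessThan intro!: sum.cong)
    also have "\<dots> = (if i = j then 1 else 0)"
    proof (cases "i = j")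
      case True
      define r where "r = Re (ws ! j \<bullet>c ws ! j)"
      have "ws ! j \<bullet>c ws ! j = complex_of_real r"
        using sq[OF ij(2)] by (simp add: r_def)
      moreover have "cnj (c j) * c j = complex_of_real ((1 / sqrt r)\<^sup>2)"
        by (simp only: c_def r_def complex_cnj_complex_of_real power2_eq_square of_real_mult)
      ultimately have "cnj (c j) * c j * (ws ! j \<bullet>c ws ! j) = complex_of_real ((1 / sqrt r)\<^sup>2 * r)"
        by simp
      also have "\<dots> = 1" using pos[OF ij(2)] by (simp add: power_divide r_def)
      finally show ?thesis using True by simp
    next
      case False
      then show ?thesis using corthogonalD[OF ws(2), of j i] ws ij by simp
    qed
    finally show "(mat_adjoint W * W) $$ (i, j) = 1\<^sub>m n $$ (i, j)" using ij by simp
  qed (auto simp: W_def)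
  moreover have "col W 0 = c 0 \<cdot>\<^sub>v v"
    using n v ws0 by (intro eq_vecI) (auto simp: W_def)
  moreover have "c 0 \<noteq> 0" using pos[OF n] by (simp add: c_def)
  moreover have "W \<in> carrier_mat n n" by (simp add: W_def)
  ultimately show ?thesis unfolding is_unitary_def by blast
qed

text \<open>Lets a unitary found for the trailing block act on the whole space while fixing the
  first coordinate.\<close>

lemma unitary_block_diag:
  assumes V: "is_unitary n V"
  shows "is_unitary (Suc n) (four_block_mat (1\<^sub>m 1) (0\<^sub>m 1 n) (0\<^sub>m n 1) V)" (is "is_unitary _ ?P")
    and "mat_adjoint (four_block_mat (1\<^sub>m 1) (0\<^sub>m 1 n) (0\<^sub>m n 1) V)
      = four_block_mat (1\<^sub>m 1) (0\<^sub>m 1 n) (0\<^sub>m n 1) (mat_adjoint V)" (is "_ = ?Q")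
proof -
  note v = is_unitaryD[OF V]
  have [simp]: "dim_row V = n" "dim_col V = n" using v(1) by auto
  show adj: "mat_adjoint ?P = ?Q"
    by (rule eq_matI) auto
  have P: "?P \<in> carrier_mat (Suc n) (Suc n)"
    using four_block_carrier_mat[of "1\<^sub>m 1" 1 1 V n n] v(1) by simp
  have "?Q * ?P = four_block_mat (1\<^sub>m 1) (0\<^sub>m 1 n) (0\<^sub>m n 1) (1\<^sub>m n)"
    using v by (subst mult_four_block_mat[of _ 1 1 _ n _ n _ _ 1 _ n]) auto
  also have "\<dots> = 1\<^sub>m (Suc n)"
    by (rule eq_matI) auto
  finally show "is_unitary (Suc n) ?P"
    using P unfolding is_unitary_def adj by blast
qed

text \<open>Deflation: with an eigenvector as first basis vector, the first column becomes zero
  below its top entry, and the induction hypothesis triangularizes the trailing block.\<close>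

lemma unitary_schur:
  "A \<in> carrier_mat n n \<Longrightarrow> \<exists>U. is_unitary n U \<and> upper_triangular (conj_by U A)"
proof (induction n arbitrary: A)
  case 0
  then show ?case
    by (intro exI[of _ "1\<^sub>m 0"]) (auto simp: is_unitary_def conj_by_def upper_triangular_def)
next
  case (Suc n)
  note A = Suc.prems
  obtain e where "e \<in> spectrum A" using spectrum_non_empty[OF A] by auto
  then obtain v where v: "v \<in> carrier_vec (Suc n)" "v \<noteq> 0\<^sub>v (Suc n)" "A *\<^sub>v v = e \<cdot>\<^sub>v v"
    using A by (auto simp: spectrum_def eigenvalue_def eigenvector_def)
  obtain W c where W: "is_unitary (Suc n) W" and col: "col W 0 = c \<cdot>\<^sub>v v"
    using unitary_first_column[OF v(1,2)] by blast
  note w = is_unitaryD[OF W]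
  define B where "B = conj_by W A"
  have B: "B \<in> carrier_mat (Suc n) (Suc n)" using w A by (simp add: B_def)
  \<comment> \<open>Column 0 of \<open>W\<close> is an eigenvector, so column 0 of \<open>B\<close>
    is \<open>e\<close> times column 0 of \<open>mat_adjoint W * W\<close>, the identity.\<close>
  have Bi0: "B $$ (i, 0) = (if i = 0 then e else 0)" if i: "i < Suc n" for i
  proof -
    have "col (A * W) 0 = A *\<^sub>v (c \<cdot>\<^sub>v v)"
      unfolding col[symmetric] by (rule col_mult2[OF A w(1)]) simp
    also have "\<dots> = e \<cdot>\<^sub>v col W 0"
      unfolding mult_mat_vec[OF A v(1)] v(3) col by (simp add: smult_smult_assoc mult.commute)
    finally have "col (A * W) 0 = e \<cdot>\<^sub>v col W 0" .
    then have AW: "(A * W) $$ (l, 0) = e * W $$ (l, 0)" if "l < Suc n" for l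
      using A w that by (metis carrier_matD index_col index_mult_mat(2,3) index_smult_vec(1) dim_col zero_less_Suc)
    have "B $$ (i, 0) = (mat_adjoint W * (A * W)) $$ (i, 0)"
      using A w by (simp add: B_def conj_by_def assoc_mult_mat[of _ "Suc n" "Suc n" _ "Suc n" _ "Suc n"])
    also have "\<dots> = e * (\<Sum>l<Suc n. mat_adjoint W $$ (i, l) * W $$ (l, 0))"
      using A w i by (subst mat_mult_index[of _ "Suc n" "Suc n" _ "Suc n"])
        (auto simp: AW sum_distrib_left simp del: index_mult_mat sum.lessThan_Suc intro!: sum.cong)
    also have "\<dots> = e * (mat_adjoint W * W) $$ (i, 0)"
      using w i by (subst mat_mult_index[of _ "Suc n" "Suc n" _ "Suc n"]) auto
    finally show ?thesis using w i by simp
  qed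
  define B1 B2 B3 where "B1 = mat 1 1 (\<lambda>_. e)" and "B2 = mat 1 n (\<lambda>(i, j). B $$ (0, Suc j))"
    and "B3 = mat n n (\<lambda>(i, j). B $$ (Suc i, Suc j))"
  have Bb: "B = four_block_mat B1 B2 (0\<^sub>m n 1) B3"
    using B Bi0 by (intro eq_matI) (auto simp: B1_def B2_def B3_def)
  have B123: "B1 \<in> carrier_mat 1 1" "B2 \<in> carrier_mat 1 n" "B3 \<in> carrier_mat n n"
    by (auto simp: B1_def B2_def B3_def)
  obtain V where V: "is_unitary n V" and ut: "upper_triangular (conj_by V B3)"
    using Suc.IH[OF B123(3)] by blast
  note v = is_unitaryD[OF V]
  let ?P = "four_block_mat (1\<^sub>m 1) (0\<^sub>m 1 n) (0\<^sub>m n 1) V"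
  have P: "is_unitary (Suc n) ?P" by (rule unitary_block_diag[OF V])
  \<comment> \<open>The zero block below \<open>e\<close> survives, and the trailing block is
    conjugated by \<open>V\<close>.\<close>
  have 1: "conj_by ?P B = four_block_mat B1 (B2 * V) (0\<^sub>m n 1) (conj_by V B3)"
  proof -
    have "mat_adjoint ?P * B = four_block_mat B1 B2 (0\<^sub>m n 1) (mat_adjoint V * B3)"
      unfolding Bb unitary_block_diag(2)[OF V] using B123 v(1)
      by (subst mult_four_block_mat[of _ 1 1 _ n _ n _ _ 1 _ n])
        (auto simp: mult_carrier_mat[of _ n n _ n])
    also have "\<dots> * ?P = four_block_mat B1 (B2 * V) (0\<^sub>m n 1) (conj_by V B3)"
      using B123 v(1) mult_carrier_mat[of "mat_adjoint V" n n B3 n]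
      by (subst mult_four_block_mat[of _ 1 1 _ n _ n _ _ 1 _ n])
        (auto simp: conj_by_def mult_carrier_mat[of _ n n _ n] mult_carrier_mat[of _ 1 n _ n])
    finally show ?thesis by (simp add: conj_by_def)
  qed
  have "upper_triangular (conj_by ?P B)"
    unfolding 1 using B123 v(1) ut
    by (intro upper_triangular_four_block[of _ 1 _ n]) (auto simp: upper_triangular_def)
  moreover have "conj_by ?P B = conj_by (W * ?P) A"
    unfolding B_def using conj_by_conj_by w(1) is_unitaryD(1)[OF P] A by blast
  ultimately show ?case
    using is_unitary_mult[OF W P] by metis
qed

text \<open>Row by row: the earlier rows and triangularity reduce column i to its diagonal entry.
  Normality gives row i the same norm as column i, so nothing is left in row i off the
  diagonal.\<close>

lemma normal_upper_triangular_diagonal: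
  assumes T: "T \<in> normal_mats n" and ut: "upper_triangular T" and "i < n" "j < n" "i \<noteq> j"
  shows "T $$ (i, j) = 0"
proof -
  have Tc: "T \<in> carrier_mat n n" and eq: "T * mat_adjoint T = mat_adjoint T * T"
    using T by (auto simp: normal_mats_def)
  have "i < n \<Longrightarrow> \<forall>j<n. j \<noteq> i \<longrightarrow> T $$ (i, j) = 0" for i
  proof (induction i rule: less_induct)
    case (less i)
    have "(\<Sum>k<n. (cmod (T $$ (k, i)))\<^sup>2) = (\<Sum>k\<in>{i}. (cmod (T $$ (k, i)))\<^sup>2)"
    proof (rule sum.mono_neutral_right)
      show "\<forall>k\<in>{..<n} - {i}. (cmod (T $$ (k, i)))\<^sup>2 = 0"
      proof
        fix k assume "k \<in> {..<n} - {i}"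
        then show "(cmod (T $$ (k, i)))\<^sup>2 = 0"
          using less.IH[of k] less.prems upper_triangularD[OF ut, of i k] Tc
          by (cases "k < i") auto
      qed
    qed (use less.prems in auto)
    moreover have "(\<Sum>k<n. (cmod (T $$ (i, k)))\<^sup>2) = (\<Sum>k<n. (cmod (T $$ (k, i)))\<^sup>2)"
    proof -
      have "complex_of_real (\<Sum>k<n. (cmod (T $$ (i, k)))\<^sup>2) = (T * mat_adjoint T) $$ (i, i)"
        using Tc less.prems by (subst mat_mult_index[of _ n n _ n]) (auto simp: mult_cnj_eq_cmod)
      also have "\<dots> = complex_of_real (\<Sum>k<n. (cmod (T $$ (k, i)))\<^sup>2)"
        unfolding eq using Tc less.prems
        by (subst mat_mult_index[of _ n n _ n]) (auto simp: mult_cnj_eq_cmod)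
      finally show ?thesis by (simp only: of_real_eq_iff)
    qed
    moreover have "(\<Sum>k<n. (cmod (T $$ (i, k)))\<^sup>2)
        = (cmod (T $$ (i, i)))\<^sup>2 + (\<Sum>k\<in>{..<n} - {i}. (cmod (T $$ (i, k)))\<^sup>2)"
      using less.prems by (simp add: sum.remove)
    ultimately have "(\<Sum>k\<in>{..<n} - {i}. (cmod (T $$ (i, k)))\<^sup>2) = 0" by simp
    then show ?case by (subst (asm) sum_nonneg_eq_0_iff) auto
  qed
  then show ?thesis using assms by auto
qed

lemma normal_diagonalization:
  assumes N: "N \<in> normal_mats n"
  shows "\<exists>U d. is_unitary n U \<and> conj_by U N = mat_diag n d"
proof -
  have Nc: "N \<in> carrier_mat n n" using N by (simp add: normal_mats_def)
  obtain U where U: "is_unitary n U" "upper_triangular (conj_by U N)"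
    using unitary_schur[OF Nc] by blast
  let ?T = "conj_by U N"
  have "?T = mat_diag n (\<lambda>i. ?T $$ (i, i))"
    using normal_upper_triangular_diagonal[OF conj_by_normal[OF U(1) N] U(2)]
      conj_by_carrier[OF is_unitaryD(1)[OF U(1)] Nc]
    by (intro eq_matI) (auto simp: mat_diag_def)
  then show ?thesis using U(1) by blast
qed

section \<open>Variance under weights and the form of a matrix with zero diagonal\<close>

text \<open>For weights of total one this is one minus the sum of their squares; for nonnegative
  weights it measures the distance from a point mass.\<close>

definition off_diag_mass :: "nat \<Rightarrow> (nat \<Rightarrow> real) \<Rightarrow> real" where
  "off_diag_mass n p = (\<Sum>k<n. \<Sum>l<n. if k = l then 0 else p k * p l)"

lemma off_diag_mass_nonneg: "(\<And>k. p k \<ge> 0) \<Longrightarrow> off_diag_mass n p \<ge> 0"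
  by (auto simp: off_diag_mass_def intro!: sum_nonneg)

lemma off_diag_mass_zeroD:
  assumes "off_diag_mass n p = 0" "\<And>k. p k \<ge> 0" "k < n" "l < n" "k \<noteq> l"
  shows "p k * p l = 0"
proof -
  have "(\<Sum>l<n. if k = l then 0 else p k * p l) = 0"
    using assms unfolding off_diag_mass_def
    by (subst (asm) sum_nonneg_eq_0_iff) (auto intro!: sum_nonneg)
  then show ?thesis
    using assms by (subst (asm) sum_nonneg_eq_0_iff) (auto split: if_splits)
qed

text \<open>Expanding the square splits the double sum into products of single sums. The pairwise
  form contains only differences of values, which a gap controls.\<close>

lemma variance_eq:
  fixes p :: "nat \<Rightarrow> real"
  assumes "(\<Sum>k<n. p k) = 1"
  shows "2 * ((\<Sum>k<n. (x k)\<^sup>2 * p k) - (\<Sum>k<n. x k * p k)\<^sup>2)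
    = (\<Sum>k<n. \<Sum>l<n. p k * p l * (x k - x l)\<^sup>2)"
proof -
  have "(\<Sum>k<n. \<Sum>l<n. p k * p l * (x k - x l)\<^sup>2)
    = (\<Sum>k<n. \<Sum>l<n. ((x k)\<^sup>2 * p k) * p l + p k * ((x l)\<^sup>2 * p l) - 2 * ((x k * p k) * (x l * p l)))"
    by (intro sum.cong refl) (simp add: power2_eq_square algebra_simps)
  also have "\<dots> = (\<Sum>k<n. (x k)\<^sup>2 * p k) * (\<Sum>k<n. p k) + (\<Sum>k<n. p k) * (\<Sum>k<n. (x k)\<^sup>2 * p k)
      - 2 * ((\<Sum>k<n. x k * p k) * (\<Sum>k<n. x k * p k))"
    by (simp only: sum_subtractf sum.distrib sum_product flip: sum_distrib_left)
  finally show ?thesis using assms by (simp add: power2_eq_square)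
qed

text \<open>Each term of the pairwise form with distinct indices is bounded below through the gap;
  the factor 1/2 arises because ordered pairs count every difference twice.\<close>

lemma variance_ge_off_diag_mass:
  fixes p :: "nat \<Rightarrow> real"
  assumes "(\<Sum>k<n. p k) = 1" "\<And>k. p k \<ge> 0" "\<delta> \<ge> 0"
    and "\<And>i j. i < n \<Longrightarrow> j < n \<Longrightarrow> i \<noteq> j \<Longrightarrow> \<delta> \<le> \<bar>x i - x j\<bar>"
  shows "\<delta>\<^sup>2 / 2 * off_diag_mass n p \<le> (\<Sum>k<n. (x k)\<^sup>2 * p k) - (\<Sum>k<n. x k * p k)\<^sup>2"
proof -
  have "\<delta>\<^sup>2 * off_diag_mass n p \<le> (\<Sum>k<n. \<Sum>l<n. p k * p l * (x k - x l)\<^sup>2)"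
    unfolding off_diag_mass_def sum_distrib_left
  proof (intro sum_mono)
    fix k l assume kl: "k \<in> {..<n}" "l \<in> {..<n}"
    show "\<delta>\<^sup>2 * (if k = l then 0 else p k * p l) \<le> p k * p l * (x k - x l)\<^sup>2"
    proof (cases "k = l")
      case False
      then have "\<delta>\<^sup>2 \<le> (x k - x l)\<^sup>2"
        using assms(3) assms(4)[of k l] kl by (metis lessThan_iff power2_abs power_mono)
      then show ?thesis
        using False assms(2) by (simp add: mult_left_mono mult.commute[of "\<delta>\<^sup>2"])
    qed simp
  qed
  moreover have "a / 2 * b \<le> c" if "a * b \<le> 2 * c" for a b c :: real
    using that by simp
  ultimately show ?thesis using variance_eq[OF assms(1), of x] by metis
qed

text \<open>Cauchy-Schwarz over index pairs. Since \<open>K\<close> vanishes on the diagonal, the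
  factor \<open>?b\<close> may be set to zero there, which leaves the off-diagonal mass in place of
  the full square of the norm of \<open>w\<close>.\<close>

lemma zero_diag_form_bound:
  fixes w :: "nat \<Rightarrow> complex"
  assumes K: "K \<in> carrier_mat n n" and diag: "\<And>i. i < n \<Longrightarrow> K $$ (i, i) = 0"
  shows "(cmod (\<Sum>k<n. \<Sum>l<n. cnj (w k) * K $$ (k, l) * w l))\<^sup>2
    \<le> frobenius_sq K * off_diag_mass n (\<lambda>k. (cmod (w k))\<^sup>2)"
proof -
  let ?I = "{..<n} \<times> {..<n}"
  let ?a = "\<lambda>(k, l). cmod (K $$ (k, l))"
  let ?b = "\<lambda>(k, l). if k = l then 0 else cmod (w k) * cmod (w l)"
  have "cmod (\<Sum>k<n. \<Sum>l<n. cnj (w k) * K $$ (k, l) * w l) \<le> (\<Sum>x\<in>?I. ?a x * ?b x)"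
    unfolding sum.cartesian_product
    by (rule order_trans[OF norm_sum], rule sum_mono) (auto simp: norm_mult diag)
  then have "(cmod (\<Sum>k<n. \<Sum>l<n. cnj (w k) * K $$ (k, l) * w l))\<^sup>2 \<le> (\<Sum>x\<in>?I. ?a x * ?b x)\<^sup>2"
    by (simp add: power_mono)
  also have "\<dots> \<le> (\<Sum>x\<in>?I. (?a x)\<^sup>2) * (\<Sum>x\<in>?I. (?b x)\<^sup>2)"
    using power_mono[OF L2_set_mult_ineq, where ?A1 = ?I and ?f1 = ?a and ?g1 = ?b and n = 2]
    by (simp add: case_prod_unfold L2_set_def power_mult_distrib sum_nonneg)
  also have "(\<Sum>x\<in>?I. (?a x)\<^sup>2) = frobenius_sq K"
    using K by (simp add: frobenius_sq_def sum.cartesian_product case_prod_unfold)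
  also have "(\<Sum>x\<in>?I. (?b x)\<^sup>2) = off_diag_mass n (\<lambda>k. (cmod (w k))\<^sup>2)"
    unfolding off_diag_mass_def sum.cartesian_product
    by (intro sum.cong) (auto simp: power_mult_distrib)
  finally show ?thesis .
qed

section \<open>Entries under conjugation and the distance to a diagonal matrix\<close>

lemma conj_by_index:
  assumes W: "W \<in> carrier_mat n n" and M: "M \<in> carrier_mat n n" and ij: "i < n" "j < n"
  shows "conj_by W M $$ (i, j) = (\<Sum>k<n. \<Sum>l<n. cnj (W $$ (k, i)) * M $$ (k, l) * W $$ (l, j))"
proof -
  have "conj_by W M $$ (i, j) = (mat_adjoint W * (M * W)) $$ (i, j)"
    using W M by (simp add: conj_by_def assoc_mult_mat[of _ n n _ n _ n])
  also have "\<dots> = (\<Sum>k<n. cnj (W $$ (k, i)) * (M * W) $$ (k, j))"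
    using W M ij by (subst mat_mult_index[of _ n n _ n]) (auto simp del: index_mult_mat)
  also have "\<dots> = (\<Sum>k<n. cnj (W $$ (k, i)) * (\<Sum>l<n. M $$ (k, l) * W $$ (l, j)))"
    using W M ij by (intro sum.cong refl) (subst mat_mult_index[of _ n n _ n]; simp)
  finally show ?thesis by (simp add: sum_distrib_left mult.assoc)
qed

lemma conj_by_uminus:
  assumes W: "W \<in> carrier_mat n n" and M: "M \<in> carrier_mat n n"
  shows "conj_by W (- M) = - conj_by W M"
proof (rule eq_matI)
  note c = carrier_matD[OF conj_by_carrier[OF W M]]
  fix i j assume "i < dim_row (- conj_by W M)" "j < dim_col (- conj_by W M)"
  then have "i < n" "j < n" using c by simp_all
  then show "conj_by W (- M) $$ (i, j) = (- conj_by W M) $$ (i, j)"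
    using M c by (simp add: conj_by_index[OF W] sum_negf)
qed (use W M in \<open>simp_all add: conj_by_def\<close>)

lemma conj_by_diag_index:
  assumes "W \<in> carrier_mat n n" and "i < n" "j < n"
  shows "conj_by W (mat_diag n f) $$ (i, j) = (\<Sum>k<n. cnj (W $$ (k, i)) * f k * W $$ (k, j))"
proof -
  have "(\<Sum>l<n. cnj (W $$ (k, i)) * mat_diag n f $$ (k, l) * W $$ (l, j))
      = cnj (W $$ (k, i)) * f k * W $$ (k, j)" if "k < n" for k
  proof -
    have "(\<Sum>l<n. cnj (W $$ (k, i)) * mat_diag n f $$ (k, l) * W $$ (l, j))
      = (\<Sum>l<n. if k = l then cnj (W $$ (k, i)) * f k * W $$ (k, j) else 0)"
      using that by (intro sum.cong) (auto simp: mat_diag_def)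
    then show ?thesis using that by simp
  qed
  then show ?thesis by (simp add: conj_by_index[OF assms(1) mat_diag_dim assms(2,3)])
qed

lemma frobenius_sq_diag_split:
  assumes "M \<in> carrier_mat n n"
  shows "frobenius_sq M = (\<Sum>i<n. (cmod (M $$ (i, i)))\<^sup>2)
    + (\<Sum>i<n. \<Sum>j\<in>{..<n} - {i}. (cmod (M $$ (i, j)))\<^sup>2)"
proof -
  have "(\<Sum>j<n. (cmod (M $$ (i, j)))\<^sup>2)
      = (cmod (M $$ (i, i)))\<^sup>2 + (\<Sum>j\<in>{..<n} - {i}. (cmod (M $$ (i, j)))\<^sup>2)" if "i < n" for i
    using that by (simp add: sum.remove)
  then have "(\<Sum>i<n. \<Sum>j<n. (cmod (M $$ (i, j)))\<^sup>2)
      = (\<Sum>i<n. (cmod (M $$ (i, i)))\<^sup>2 + (\<Sum>j\<in>{..<n} - {i}. (cmod (M $$ (i, j)))\<^sup>2))"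
    by (intro sum.cong) auto
  moreover have "frobenius_sq M = (\<Sum>i<n. \<Sum>j<n. (cmod (M $$ (i, j)))\<^sup>2)"
    using assms by (simp add: frobenius_sq_def)
  ultimately show ?thesis by (simp only: sum.distrib)
qed

text \<open>Subtraction touches the diagonal only. The last sum being nonnegative, a lower bound on
  the distance needs just an upper bound on the diagonal of \<open>M\<close>.\<close>

lemma frobenius_sq_minus_diag:
  assumes M: "M \<in> carrier_mat n n"
  shows "frobenius_sq (M - mat_diag n d) = frobenius_sq M
    - (\<Sum>i<n. (cmod (M $$ (i, i)))\<^sup>2) + (\<Sum>i<n. (cmod (M $$ (i, i) - d i))\<^sup>2)"
proof -
  have 1: "M - mat_diag n d \<in> carrier_mat n n" by (rule minus_carrier_mat) simp
  have "(M - mat_diag n d) $$ (i, j) = M $$ (i, j) - (if i = j then d i else 0)" if "i < n" "j < n" for i j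
    using that M by (simp add: mat_diag_def)
  then show ?thesis
    unfolding frobenius_sq_diag_split[OF 1] frobenius_sq_diag_split[OF M] by simp
qed

text \<open>The squared moduli form a doubly stochastic matrix: columns supply probability weights,
  rows collapse the sums taken over all columns.\<close>

lemma unitary_mass:
  assumes "is_unitary n W" "i < n"
  shows "(\<Sum>k<n. (cmod (W $$ (k, i)))\<^sup>2) = 1" "(\<Sum>k<n. (cmod (W $$ (i, k)))\<^sup>2) = 1"
proof -
  note w = is_unitaryD[OF assms(1)]
  have "complex_of_real (\<Sum>k<n. (cmod (W $$ (k, i)))\<^sup>2) = (mat_adjoint W * W) $$ (i, i)"
    using w(1) assms by (subst mat_mult_index[of _ n n _ n]) (auto simp: mult_cnj_eq_cmod)
  then show "(\<Sum>k<n. (cmod (W $$ (k, i)))\<^sup>2) = 1"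
    using w assms by (simp del: of_real_sum)
  have "complex_of_real (\<Sum>k<n. (cmod (W $$ (i, k)))\<^sup>2) = (W * mat_adjoint W) $$ (i, i)"
    using w(1) assms by (subst mat_mult_index[of _ n n _ n]) (auto simp: mult_cnj_eq_cmod)
  then show "(\<Sum>k<n. (cmod (W $$ (i, k)))\<^sup>2) = 1"
    using w assms by (simp del: of_real_sum)
qed

section \<open>The nearest normal matrix when the Hermitian part is diagonal\<close>

text \<open>The two slack terms \<open>?O\<close> and \<open>?E\<close> are kept so that one
  estimate serves both claims: their nonnegative contributions give minimality, their vanishing
  gives uniqueness.\<close>

lemma diag_distance_bound:
  fixes lam :: "nat \<Rightarrow> real" and n :: nat
  defines "D \<equiv> mat_diag n (\<lambda>i. complex_of_real (lam i))"
  assumes K: "K \<in> carrier_mat n n" and skew: "mat_adjoint K = - K"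
    and diag: "\<And>i. i < n \<Longrightarrow> K $$ (i, i) = 0"
    and gap: "\<delta> \<ge> 0" "\<And>i j. i < n \<Longrightarrow> j < n \<Longrightarrow> i \<noteq> j \<Longrightarrow> \<delta> \<le> \<bar>lam i - lam j\<bar>"
    and W: "is_unitary n W" and N: "N \<in> carrier_mat n n" and Nd: "conj_by W N = mat_diag n d"
  shows "frobenius_sq K
      + (\<delta>\<^sup>2 / 2 - frobenius_sq K) * (\<Sum>i<n. off_diag_mass n (\<lambda>k. (cmod (W $$ (k, i)))\<^sup>2))
      + (\<Sum>i<n. (cmod (conj_by W (D + K) $$ (i, i) - d i))\<^sup>2)
    \<le> frobenius_sq (D + K - N)" (is "?F + (_ - _) * ?O + ?E \<le> _")
proof -
  note w = is_unitaryD[OF W]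
  have D: "D \<in> carrier_mat n n" and DK: "D + K \<in> carrier_mat n n"
    using K by (simp_all add: D_def)
  define B where "B = conj_by W (D + K)"
  define p where "p i k = (cmod (W $$ (k, i)))\<^sup>2" for i k
  have B: "B \<in> carrier_mat n n" using w DK by (simp add: B_def)
  \<comment> \<open>\<open>D\<close> lives on the diagonal and \<open>K\<close> off it, so the
    squared norms add.\<close>
  have total: "frobenius_sq (D + K) = (\<Sum>k<n. (lam k)\<^sup>2) + frobenius_sq K"
    using K diag unfolding frobenius_sq_diag_split[OF DK] frobenius_sq_diag_split[OF K]
    by (simp add: D_def mat_diag_def)
  have "(cmod (B $$ (i, i)))\<^sup>2 \<le> (\<Sum>k<n. (lam k)\<^sup>2 * p i k) - (\<delta>\<^sup>2 / 2 - ?F) * off_diag_mass n (p i)"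
    if i: "i < n" for i
  proof -
    let ?k = "conj_by W K $$ (i, i)" and ?s = "\<Sum>k<n. lam k * p i k"
    \<comment> \<open>The weighted mean of the eigenvalues under \<open>p i\<close>, a real
      number.\<close>
    have "conj_by W D $$ (i, i) = (\<Sum>k<n. complex_of_real (lam k) * (cnj (W $$ (k, i)) * W $$ (k, i)))"
      unfolding D_def conj_by_diag_index[OF w(1) i i] by (simp add: ac_simps)
    also have "\<dots> = complex_of_real ?s"
      by (simp only: mult_cnj_eq_cmod p_def of_real_mult of_real_sum)
    finally have Bii: "B $$ (i, i) = complex_of_real ?s + ?k"
      using i w(1) D K unfolding B_def conj_by_add[OF w(1) D K]
      by (simp add: carrier_matD[OF conj_by_carrier[OF w(1) K]])
    \<comment> \<open>Skewness makes \<open>?k\<close> purely imaginary, so it is orthogonal to the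
      real mean \<open>?s\<close> and the squares add.\<close>
    have "cnj ?k = mat_adjoint (conj_by W K) $$ (i, i)"
      using i carrier_matD[OF conj_by_carrier[OF w(1) K]] by simp
    also have "\<dots> = - ?k"
      using i carrier_matD[OF conj_by_carrier[OF w(1) K]]
      by (simp add: conj_by_adjoint[OF w(1) K] skew conj_by_uminus[OF w(1) K])
    finally have "Re ?k = 0" by (metis complex_cnj_cancel_iff cnj.sel(1) equal_neg_zero uminus_complex.sel(1))
    then have "(cmod (B $$ (i, i)))\<^sup>2 = ?s\<^sup>2 + (cmod ?k)\<^sup>2"
      unfolding Bii by (simp add: cmod_power2)
    moreover have "(cmod ?k)\<^sup>2 \<le> ?F * off_diag_mass n (p i)"
      unfolding p_def conj_by_index[OF w(1) K i i] by (rule zero_diag_form_bound[OF K diag])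
    moreover have "\<delta>\<^sup>2 / 2 * off_diag_mass n (p i) \<le> (\<Sum>k<n. (lam k)\<^sup>2 * p i k) - ?s\<^sup>2"
      using unitary_mass(1)[OF W i] gap by (intro variance_ge_off_diag_mass) (auto simp: p_def)
    ultimately show ?thesis by (simp add: algebra_simps)
  qed
  then have "(\<Sum>i<n. (cmod (B $$ (i, i)))\<^sup>2)
      \<le> (\<Sum>i<n. (\<Sum>k<n. (lam k)\<^sup>2 * p i k) - (\<delta>\<^sup>2 / 2 - ?F) * off_diag_mass n (p i))"
    by (intro sum_mono) auto
  also have "\<dots> = (\<Sum>k<n. \<Sum>i<n. (lam k)\<^sup>2 * p i k) - (\<delta>\<^sup>2 / 2 - ?F) * ?O"
    by (subst sum.swap) (simp add: sum_subtractf sum_distrib_left p_def[abs_def])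
  \<comment> \<open>The row sums of the doubly stochastic weights remove \<open>p\<close>.\<close>
  also have "(\<Sum>k<n. \<Sum>i<n. (lam k)\<^sup>2 * p i k) = (\<Sum>k<n. (lam k)\<^sup>2)"
    using unitary_mass(2)[OF W] by (simp add: p_def flip: sum_distrib_left)
  finally have "(\<Sum>i<n. (cmod (B $$ (i, i)))\<^sup>2) \<le> (\<Sum>k<n. (lam k)\<^sup>2) - (\<delta>\<^sup>2 / 2 - ?F) * ?O" .
  moreover have "frobenius_sq (D + K - N) = frobenius_sq (B - mat_diag n d)"
    using frobenius_sq_conj_by[OF W, of "D + K - N"] minus_carrier_mat[OF N, of "D + K"]
      conj_by_minus[OF w(1) DK N]
    by (simp add: Nd B_def)
  moreover have "frobenius_sq B = frobenius_sq (D + K)"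
    unfolding B_def by (rule frobenius_sq_conj_by[OF W DK])
  ultimately show ?thesis
    unfolding frobenius_sq_minus_diag[OF B] total B_def[symmetric] by simp
qed

text \<open>Dropping the slack gives the first claim. In the strict case equality forces
  \<open>R = 0\<close> and \<open>E = 0\<close>: each column of \<open>W\<close> sits on one
  coordinate, and \<open>d\<close> lists the eigenvalues found there.\<close>

lemma diag_nearest:
  fixes lam :: "nat \<Rightarrow> real" and n :: nat
  defines "D \<equiv> mat_diag n (\<lambda>i. complex_of_real (lam i))"
  assumes K: "K \<in> carrier_mat n n" and skew: "mat_adjoint K = - K"
    and diag: "\<And>i. i < n \<Longrightarrow> K $$ (i, i) = 0"
    and gap: "\<delta> \<ge> 0" "\<And>i j. i < n \<Longrightarrow> j < n \<Longrightarrow> i \<noteq> j \<Longrightarrow> \<delta> \<le> \<bar>lam i - lam j\<bar>"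
    and small: "frobenius_sq K \<le> \<delta>\<^sup>2 / 2" and N: "N \<in> normal_mats n"
  shows "frobenius_sq K \<le> frobenius_sq (D + K - N)"
    and "frobenius_sq K < \<delta>\<^sup>2 / 2 \<Longrightarrow> frobenius_sq (D + K - N) \<le> frobenius_sq K \<Longrightarrow> N = D"
proof -
  have Nc: "N \<in> carrier_mat n n" using N by (simp add: normal_mats_def)
  obtain W d where W: "is_unitary n W" and Nd: "conj_by W N = mat_diag n d"
    using normal_diagonalization[OF N] by blast
  note w = is_unitaryD[OF W]
  have D: "D \<in> carrier_mat n n" by (simp add: D_def)
  define p where "p i k = (cmod (W $$ (k, i)))\<^sup>2" for i k
  define E where "E = (\<Sum>i<n. (cmod (conj_by W (D + K) $$ (i, i) - d i))\<^sup>2)"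
  define R where "R = (\<Sum>i<n. off_diag_mass n (p i))"
  have bound: "frobenius_sq K + (\<delta>\<^sup>2 / 2 - frobenius_sq K) * R + E \<le> frobenius_sq (D + K - N)"
    using diag_distance_bound[OF K skew diag gap W Nc Nd]
    by (simp add: D_def E_def R_def p_def[abs_def])
  have off: "off_diag_mass n (p i) \<ge> 0" for i by (rule off_diag_mass_nonneg) (simp add: p_def)
  have ER: "E \<ge> 0" "R \<ge> 0" by (auto simp: E_def R_def off intro!: sum_nonneg)
  then have "(\<delta>\<^sup>2 / 2 - frobenius_sq K) * R \<ge> 0" using small by simp
  with ER bound show "frobenius_sq K \<le> frobenius_sq (D + K - N)" by linarith
  assume lt: "frobenius_sq K < \<delta>\<^sup>2 / 2" and le: "frobenius_sq (D + K - N) \<le> frobenius_sq K"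
  from bound le ER \<open>(\<delta>\<^sup>2 / 2 - frobenius_sq K) * R \<ge> 0\<close>
  have "E = 0" "(\<delta>\<^sup>2 / 2 - frobenius_sq K) * R = 0" by linarith+
  with lt have "R = 0" by simp
  then have off0: "off_diag_mass n (p i) = 0" if "i < n" for i
    using that off unfolding R_def by (subst (asm) sum_nonneg_eq_0_iff) auto
  have pp: "p i k * p i l = 0" if "i < n" "k < n" "l < n" "k \<noteq> l" for i k l
    using off_diag_mass_zeroD[OF off0[OF that(1)] _ that(2-4)] by (simp add: p_def)
  \<comment> \<open>\<open>E = 0\<close> identifies \<open>d i\<close> with a diagonal entry; zero
    off-diagonal mass kills the contribution of \<open>K\<close> to it, leaving the mean.\<close>
  have d: "d i = complex_of_real (\<Sum>k<n. lam k * p i k)" if i: "i < n" for i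
  proof -
    have "d i = conj_by W (D + K) $$ (i, i)"
      using \<open>E = 0\<close> i unfolding E_def by (subst (asm) sum_nonneg_eq_0_iff) auto
    also have "\<dots> = conj_by W D $$ (i, i) + conj_by W K $$ (i, i)"
      using i unfolding conj_by_add[OF w(1) D K]
      by (simp add: carrier_matD[OF conj_by_carrier[OF w(1) K]])
    also have "conj_by W K $$ (i, i) = 0"
    proof -
      have "(cmod (conj_by W K $$ (i, i)))\<^sup>2 \<le> frobenius_sq K * off_diag_mass n (p i)"
        unfolding p_def conj_by_index[OF w(1) K i i] by (rule zero_diag_form_bound[OF K diag])
      then show ?thesis using off0[OF i] by simp
    qed
    also have "conj_by W D $$ (i, i) = (\<Sum>k<n. complex_of_real (lam k) * (cnj (W $$ (k, i)) * W $$ (k, i)))"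
      unfolding D_def conj_by_diag_index[OF w(1) i i] by (simp add: ac_simps)
    also have "\<dots> = complex_of_real (\<Sum>k<n. lam k * p i k)"
      by (simp only: mult_cnj_eq_cmod p_def of_real_mult of_real_sum)
    finally show ?thesis by simp
  qed
  \<comment> \<open>By \<open>pp\<close> the weights of column i are a point mass at
    \<open>k\<close>, so the mean is \<open>lam k\<close>.\<close>
  have dk: "d i = complex_of_real (lam k)" if "i < n" "k < n" "p i k \<noteq> 0" for i k
  proof -
    have z: "p i l = 0" if "l < n" "l \<noteq> k" for l using pp[of i k l] that \<open>i < n\<close> \<open>k < n\<close> \<open>p i k \<noteq> 0\<close> by auto
    have single: "(\<Sum>l<n. f l * p i l) = f k * p i k" for f
    proof -
      have "(\<Sum>l<n. f l * p i l) = (\<Sum>l\<in>{k}. f l * p i l)"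
        using z \<open>k < n\<close> by (intro sum.mono_neutral_right) auto
      then show ?thesis by simp
    qed
    have "p i k = 1" using unitary_mass(1)[OF W \<open>i < n\<close>] single[of "\<lambda>_. 1"] by (simp add: p_def)
    then show ?thesis using d[OF \<open>i < n\<close>] single[of lam] by simp
  qed
  have Wa: "mat_adjoint W \<in> carrier_mat n n" using w by simp
  have N_index: "N $$ (k, l) = (\<Sum>i<n. W $$ (k, i) * d i * cnj (W $$ (l, i)))" if "k < n" "l < n" for k l
  proof -
    have "N $$ (k, l) = conj_by (mat_adjoint W) (mat_diag n d) $$ (k, l)"
      using conj_by_cancel[OF W Nc] by (simp add: Nd)
    also have "\<dots> = (\<Sum>i<n. W $$ (k, i) * d i * cnj (W $$ (l, i)))"
      unfolding conj_by_diag_index[OF Wa that] using w(1) that by (intro sum.cong) auto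
    finally show ?thesis .
  qed
  show "N = D"
  proof (rule eq_matI)
    fix k l assume "k < dim_row D" "l < dim_col D"
    then have kl: "k < n" "l < n" using D by auto
    \<comment> \<open>Each summand is zero or has \<open>d i\<close> equal to \<open>lam k\<close>,
      so the eigenvalue leaves the sum and the rows of \<open>W\<close> remain, which are
      orthonormal.\<close>
    have "N $$ (k, l) = (\<Sum>i<n. complex_of_real (lam k) * (W $$ (k, i) * mat_adjoint W $$ (i, l)))"
      unfolding N_index[OF kl]
    proof (intro sum.cong refl)
      fix i assume "i \<in> {..<n}"
      then have i: "i < n" by simp
      show "W $$ (k, i) * d i * cnj (W $$ (l, i)) = complex_of_real (lam k) * (W $$ (k, i) * mat_adjoint W $$ (i, l))"
        using dk[OF i kl(1)] w(1) i kl by (cases "W $$ (k, i) = 0") (auto simp: p_def)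
    qed
    also have "\<dots> = complex_of_real (lam k) * (W * mat_adjoint W) $$ (k, l)"
      using w(1) Wa kl by (subst mat_mult_index[of _ n n _ n]) (auto simp: sum_distrib_left)
    also have "\<dots> = D $$ (k, l)" using w(3) kl by (simp add: D_def mat_diag_def)
    finally show "N $$ (k, l) = D $$ (k, l)" .
  qed (use Nc D in auto)
qed

section \<open>A real orthonormal eigenbasis of the symmetric part\<close>

text \<open>The bijection encodes n distinct real eigenvalues. One eigenvector is chosen for each;
  symmetry makes them orthogonal because the eigenvalues differ, and scaling finishes.\<close>

lemma symmetric_distinct_spectrum_eigenbasis:
  fixes S :: "real mat"
  assumes S: "S \<in> carrier_mat n n" and sym: "transpose_mat S = S"
    and lam: "bij_betw lam {..<n} (spectrum S)"
  shows "\<exists>v. (\<forall>i<n. v i \<in> carrier_vec n \<and> S *\<^sub>v v i = lam i \<cdot>\<^sub>v v i) \<and>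
    (\<forall>i<n. \<forall>j<n. v i \<bullet> v j = (if i = j then 1 else 0))"
proof -
  have "\<exists>u. u \<in> carrier_vec n \<and> S *\<^sub>v u = lam i \<cdot>\<^sub>v u \<and> u \<noteq> 0\<^sub>v n" if "i < n" for i
  proof -
    have "lam i \<in> spectrum S" using lam that by (auto simp: bij_betw_def)
    then show ?thesis using S by (auto simp: spectrum_def eigenvalue_def eigenvector_def)
  qed
  then obtain u where u: "\<And>i. i < n \<Longrightarrow> u i \<in> carrier_vec n"
    "\<And>i. i < n \<Longrightarrow> S *\<^sub>v u i = lam i \<cdot>\<^sub>v u i" "\<And>i. i < n \<Longrightarrow> u i \<noteq> 0\<^sub>v n"
    by metis
  have orth: "u i \<bullet> u j = 0" if ij: "i < n" "j < n" "i \<noteq> j" for i j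
  proof -
    have "lam i * (u i \<bullet> u j) = (S *\<^sub>v u i) \<bullet> u j"
      using u ij by (simp add: smult_scalar_prod_distrib[of _ n])
    also have "\<dots> = u i \<bullet> (S *\<^sub>v u j)"
      using transpose_vec_mult_scalar[OF S, of "u j" "u i"] u ij by (simp add: sym)
    also have "\<dots> = lam j * (u i \<bullet> u j)"
      using u ij by (simp add: scalar_prod_smult_distrib[of _ n])
    finally have "(lam i - lam j) * (u i \<bullet> u j) = 0" by (simp add: algebra_simps)
    moreover have "lam i \<noteq> lam j"
      using lam ij by (auto simp: bij_betw_def inj_on_def)
    ultimately show ?thesis by simp
  qed
  have pos: "u i \<bullet> u i > 0" if "i < n" for i
  proof -
    have "u i \<bullet> u i \<ge> 0" by (simp add: scalar_prod_def sum_nonneg)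
    \<comment> \<open>Over the reals the conjugate form is the plain scalar product, so its
      definiteness carries over.\<close>
    moreover have "conjugate (u i) = u i" by (intro eq_vecI) auto
    ultimately show ?thesis
      using conjugate_square_eq_0_vec[OF u(1)[OF that]] u(3)[OF that] by fastforce
  qed
  define v where "v i = (1 / sqrt (u i \<bullet> u i)) \<cdot>\<^sub>v u i" for i
  have "v i \<bullet> v j = (if i = j then 1 else 0)" if "i < n" "j < n" for i j
    using u(1) that orth[of i j] pos[of j]
    by (simp add: v_def smult_scalar_prod_distrib[of _ n] scalar_prod_smult_distrib[of _ n])
  moreover have "v i \<in> carrier_vec n" "S *\<^sub>v v i = lam i \<cdot>\<^sub>v v i" if "i < n" for i
    using u(1,2) that S
    by (simp_all add: v_def mult_mat_vec[of S n n] smult_smult_assoc mult.commute)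
  ultimately show ?thesis by blast
qed

text \<open>The eigenvectors become the columns of \<open>V\<close>. Real entries are recorded
  because they keep the diagonal of the skew part zero in the new basis.\<close>

lemma real_unitary_diagonalization:
  fixes S :: "real mat"
  assumes S: "S \<in> carrier_mat n n" and sym: "transpose_mat S = S"
    and lam: "bij_betw lam {..<n} (spectrum S)"
  shows "\<exists>V. is_unitary n V \<and> (\<forall>k<n. \<forall>i<n. V $$ (k, i) \<in> \<real>) \<and>
    conj_by V (map_mat complex_of_real S) = mat_diag n (\<lambda>i. complex_of_real (lam i))"
proof -
  obtain v where v: "\<And>i. i < n \<Longrightarrow> v i \<in> carrier_vec n"
    "\<And>i. i < n \<Longrightarrow> S *\<^sub>v v i = lam i \<cdot>\<^sub>v v i"
    "\<And>i j. i < n \<Longrightarrow> j < n \<Longrightarrow> v i \<bullet> v j = (if i = j then 1 else 0)"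
    using symmetric_distinct_spectrum_eigenbasis[OF assms] by blast
  define V where "V = mat n n (\<lambda>(k, i). complex_of_real (v i $ k))"
  let ?S = "map_mat complex_of_real S" and ?D = "mat_diag n (\<lambda>i. complex_of_real (lam i))"
  have V: "V \<in> carrier_mat n n" and Sc: "?S \<in> carrier_mat n n" using S by (simp_all add: V_def)
  have "mat_adjoint V * V = 1\<^sub>m n"
  proof (rule eq_matI)
    fix i j assume "i < dim_row (1\<^sub>m n :: complex mat)" "j < dim_col (1\<^sub>m n :: complex mat)"
    then have ij: "i < n" "j < n" by auto
    then have "(mat_adjoint V * V) $$ (i, j) = (\<Sum>k<n. complex_of_real (v i $ k * v j $ k))"
      by (subst mat_mult_index[of _ n n _ n]) (auto simp: V_def)
    also have "\<dots> = complex_of_real (v i \<bullet> v j)"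
      using carrier_vecD[OF v(1)] ij by (simp add: scalar_prod_def atLeast0LessThan)
    finally show "(mat_adjoint V * V) $$ (i, j) = 1\<^sub>m n $$ (i, j)" using v(3) ij by simp
  qed (use V in simp_all)
  then have U: "is_unitary n V" using V by (simp add: is_unitary_def)
  have "?S * V = V * ?D"
  proof (rule eq_matI)
    fix k i assume "k < dim_row (V * ?D)" "i < dim_col (V * ?D)"
    then have ki: "k < n" "i < n" using V by (simp_all add: mat_diag_def)
    then have "(?S * V) $$ (k, i) = (\<Sum>l<n. complex_of_real (S $$ (k, l) * v i $ l))"
      using S by (subst mat_mult_index[of _ n n _ n]) (auto simp: V_def)
    also have "\<dots> = complex_of_real ((S *\<^sub>v v i) $ k)"
      using S carrier_vecD[OF v(1)] ki by (simp add: scalar_prod_def atLeast0LessThan)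
    also have "\<dots> = (V * ?D) $$ (k, i)"
      using ki carrier_vecD[OF v(1)] by (simp add: v(2) mat_diag_mult_right[OF V]) (simp add: V_def)
    finally show "(?S * V) $$ (k, i) = (V * ?D) $$ (k, i)" .
  qed (use V S in \<open>simp_all add: mat_diag_def\<close>)
  then have "conj_by V ?S = mat_adjoint V * (V * ?D)"
    using V Sc by (simp add: conj_by_def assoc_mult_mat[of _ n n _ n _ n])
  also have "\<dots> = ?D" by (rule unitary_cancel(1)[OF U mat_diag_dim])
  finally show ?thesis using U by (intro exI[of _ V]) (auto simp: V_def)
qed

text \<open>Real entries remove the conjugation; exchanging the two summation indices then turns the
  sum into its own negative.\<close>

lemma real_form_skew_zero:
  fixes K :: "complex mat"
  assumes V: "V \<in> carrier_mat n n" and real: "\<And>k i. k < n \<Longrightarrow> i < n \<Longrightarrow> V $$ (k, i) \<in> \<real>"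
    and K: "K \<in> carrier_mat n n" and skew: "\<And>k l. k < n \<Longrightarrow> l < n \<Longrightarrow> K $$ (l, k) = - K $$ (k, l)"
    and i: "i < n"
  shows "conj_by V K $$ (i, i) = 0"
proof -
  have eq: "conj_by V K $$ (i, i) = (\<Sum>k<n. \<Sum>l<n. V $$ (k, i) * K $$ (k, l) * V $$ (l, i))"
    using real i unfolding conj_by_index[OF V K i i]
    by (intro sum.cong refl) (simp add: Reals_cnj_iff)
  also have "\<dots> = (\<Sum>k<n. \<Sum>l<n. V $$ (l, i) * K $$ (l, k) * V $$ (k, i))"
    by (rule sum.swap)
  also have "\<dots> = - (\<Sum>k<n. \<Sum>l<n. V $$ (k, i) * K $$ (k, l) * V $$ (l, i))"
    unfolding sum_negf[symmetric]
  proof (intro sum.cong refl)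
    fix k l assume "k \<in> {..<n}" "l \<in> {..<n}"
    then show "V $$ (l, i) * K $$ (l, k) * V $$ (k, i) = - (V $$ (k, i) * K $$ (k, l) * V $$ (l, i))"
      using skew[of k l] by simp
  qed
  finally show ?thesis unfolding eq[symmetric] by simp
qed

section \<open>Transfer of the problem for \<open>A\<close> to the eigenbasis of
  \<open>S\<close>\<close>

theorem theorem3p7:
  fixes n :: nat and A S K :: "real mat" and lam :: "nat \<Rightarrow> real" and \<delta> :: real
  assumes "n \<ge> 2"
    and "A \<in> carrier_mat n n"
    and "S = (1/2) \<cdot>\<^sub>m (A + transpose_mat A)"
    and "K = (1/2) \<cdot>\<^sub>m (A - transpose_mat A)"
    and "bij_betw lam {..<n} (spectrum S)"
    and "\<delta> = Min {\<bar>lam i - lam j\<bar> | i j. i < n \<and> j < n \<and> i \<noteq> j}"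
    and "frobenius_norm K \<le> \<delta> / sqrt 2"
  shows "nearest_normal n (map_mat complex_of_real A) (map_mat complex_of_real S) \<and>
    (frobenius_norm K < \<delta> / sqrt 2 \<longrightarrow>
      (\<forall>N. nearest_normal n (map_mat complex_of_real A) N \<longrightarrow> N = map_mat complex_of_real S))"
proof -
  let ?A = "map_mat complex_of_real A" and ?S = "map_mat complex_of_real S"
    and ?K = "map_mat complex_of_real K" and ?D = "mat_diag n (\<lambda>i. complex_of_real (lam i))"
  note A = assms(2)
  have At: "transpose_mat A \<in> carrier_mat n n" using A by simp
  have S: "S \<in> carrier_mat n n" and K: "K \<in> carrier_mat n n"
    using A At minus_carrier_mat[OF At, of A] by (simp_all add: assms(3,4))
  have S_index: "S $$ (i, j) = (A $$ (i, j) + A $$ (j, i)) / 2"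
    and K_index: "K $$ (i, j) = (A $$ (i, j) - A $$ (j, i)) / 2" if "i < n" "j < n" for i j
    using A that by (simp_all add: assms(3,4))
  have S_sym: "S $$ (j, i) = S $$ (i, j)" and K_skew: "K $$ (j, i) = - K $$ (i, j)"
    and SK: "A $$ (i, j) = S $$ (i, j) + K $$ (i, j)" if "i < n" "j < n" for i j
    unfolding S_index[OF that] S_index[OF that(2,1)] K_index[OF that] K_index[OF that(2,1)]
    by (simp_all add: field_simps)
  have sym: "transpose_mat S = S"
  proof (rule eq_matI)
    fix i j assume "i < dim_row S" "j < dim_col S"
    then show "transpose_mat S $$ (i, j) = S $$ (i, j)"
      using S S_sym[of i j] by simp
  qed (use S in simp_all)
  have Ac: "?A \<in> carrier_mat n n" and Sc: "?S \<in> carrier_mat n n" and Kc: "?K \<in> carrier_mat n n"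
    using A S K by simp_all
  have ASK: "?A = ?S + ?K" and AmS: "?A - ?S = ?K"
    using A S K SK by (auto intro!: eq_matI)
  have skew: "mat_adjoint ?K = - ?K"
  proof (rule eq_matI)
    fix i j assume "i < dim_row (- ?K)" "j < dim_col (- ?K)"
    then show "mat_adjoint ?K $$ (i, j) = (- ?K) $$ (i, j)"
      using K K_skew[of i j] by simp
  qed (use K in simp_all)
  obtain V where V: "is_unitary n V" and Vreal: "\<And>k i. k < n \<Longrightarrow> i < n \<Longrightarrow> V $$ (k, i) \<in> \<real>"
    and VS: "conj_by V ?S = ?D"
    using real_unitary_diagonalization[OF S sym assms(5)] by blast
  note v = is_unitaryD[OF V]
  let ?L = "conj_by V ?K"
  have L: "?L \<in> carrier_mat n n" using v(1) Kc by simp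
  have Lskew: "mat_adjoint ?L = - ?L"
    by (simp add: conj_by_adjoint[OF v(1) Kc] skew conj_by_uminus[OF v(1) Kc])
  have Ldiag: "?L $$ (i, i) = 0" if "i < n" for i
  proof (rule real_form_skew_zero[OF v(1) Vreal Kc _ that])
    fix k l assume "k < n" "l < n"
    then show "?K $$ (l, k) = - ?K $$ (k, l)" using K K_skew[of k l] by simp
  qed
  have FK: "frobenius_norm K = sqrt (frobenius_sq ?L)"
    unfolding frobenius_sq_conj_by[OF V Kc]
    using K by (simp add: frobenius_norm_def frobenius_sq_def)
  \<comment> \<open>The sign of \<delta> is read off from the bound on the norm of \<open>K\<close>,
    which is nonnegative.\<close>
  have "\<delta> / sqrt 2 \<ge> 0" using assms(7) by (rule order_trans[rotated]) (simp add: FK)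
  then have \<delta>0: "\<delta> \<ge> 0" by (simp add: zero_le_divide_iff)
  \<comment> \<open>Both sides of the norm hypotheses are now roots, so these become inequalities
    between squares.\<close>
  have \<delta>sq: "\<delta> / sqrt 2 = sqrt (\<delta>\<^sup>2 / 2)" using \<delta>0 by (simp add: real_sqrt_divide)
  \<comment> \<open>\<open>Min\<close> is a true lower bound because the set is finite, lying in an
    image of the index square.\<close>
  have gap: "\<delta> \<le> \<bar>lam i - lam j\<bar>" if "i < n" "j < n" "i \<noteq> j" for i j
  proof -
    have "finite {\<bar>lam i - lam j\<bar> | i j. i < n \<and> j < n \<and> i \<noteq> j}"
      by (rule finite_subset[of _ "(\<lambda>(i, j). \<bar>lam i - lam j\<bar>) ` ({..<n} \<times> {..<n})"]) auto
    then show ?thesis unfolding assms(6) using that by (intro Min_le) auto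
  qed
  have small: "frobenius_sq ?L \<le> \<delta>\<^sup>2 / 2"
    using assms(7) unfolding FK \<delta>sq by simp
  \<comment> \<open>In the eigenbasis \<open>?A\<close> becomes \<open>?D + ?L\<close>, and unitary
    conjugation preserves distances.\<close>
  have dist: "frobenius_sq (?A - N) = frobenius_sq (?D + ?L - conj_by V N)" if "N \<in> carrier_mat n n" for N
    using frobenius_sq_conj_by[OF V, of "?A - N"] minus_carrier_mat[OF that, of ?A]
      conj_by_minus[OF v(1) Ac that] conj_by_add[OF v(1) Sc Kc]
    by (simp add: VS ASK)
  have S_normal: "?S \<in> normal_mats n"
  proof -
    have "mat_adjoint ?S = ?S"
    proof (rule eq_matI)
      fix i j assume "i < dim_row ?S" "j < dim_col ?S"
      then show "mat_adjoint ?S $$ (i, j) = ?S $$ (i, j)"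
        using S S_sym[of i j] by simp
    qed (use S in simp_all)
    then show ?thesis using Sc by (simp add: normal_mats_def)
  qed
  have AS: "frobenius_sq (?A - ?S) = frobenius_sq ?L"
    unfolding AmS by (rule frobenius_sq_conj_by[OF V Kc, symmetric])
  have normal: "N \<in> carrier_mat n n" "conj_by V N \<in> normal_mats n" if "N \<in> normal_mats n" for N
    using that conj_by_normal[OF V] by (auto simp: normal_mats_def)
  have "frobenius_norm (?A - ?S) \<le> frobenius_norm (?A - N)" if N: "N \<in> normal_mats n" for N
    using diag_nearest(1)[where lam = lam, OF L Lskew Ldiag \<delta>0 gap small normal(2)[OF N]]
    by (simp add: frobenius_norm_complex AS dist normal(1)[OF N])
  then have 1: "nearest_normal n ?A ?S"
    using S_normal by (simp add: nearest_normal_def)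
  \<comment> \<open>Another minimizer is no farther from \<open>?A\<close> than \<open>?S\<close>;
    the equality case yields \<open>?D\<close> in the eigenbasis, and conjugating back gives
    \<open>?S\<close>.\<close>
  have "N = ?S" if lt: "frobenius_norm K < \<delta> / sqrt 2" and nn: "nearest_normal n ?A N" for N
  proof -
    have N: "N \<in> normal_mats n" and "frobenius_norm (?A - N) \<le> frobenius_norm (?A - ?S)"
      using nn S_normal by (auto simp: nearest_normal_def)
    then have "frobenius_sq (?D + ?L - conj_by V N) \<le> frobenius_sq ?L"
      by (simp add: frobenius_norm_complex AS dist normal(1)[OF N])
    moreover have "frobenius_sq ?L < \<delta>\<^sup>2 / 2" using lt unfolding FK \<delta>sq by simp
    ultimately have "conj_by V N = ?D"
      using diag_nearest(2)[where lam = lam, OF L Lskew Ldiag \<delta>0 gap small normal(2)[OF N]] by blast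
    then show ?thesis
      using conj_by_cancel[OF V normal(1)[OF N]] conj_by_cancel[OF V Sc] by (simp add: VS)
  qed
  with 1 show ?thesis by blast
qed

end
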